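(* Let $H$ be a graph, $t\ge 1$, $G=H\square K_2^{\square t}=(V,E)$, let $(G,p)$ be a framework in $\mathbb{R}^d$ with $t$-fold extrusion symmetry (and extrusion directions $\tau_1,\ldots,\tau_t$), let $\Gamma=\mathbb{Z}_2^t$ and let $\theta:\Gamma\to \mathrm{Aut}(G)$ be the extrusion action. Then the rigidity matrix $R(G,p)$ is a $\Gamma$-linear map of $P_V\otimes I_d$ and $P'_E$, i.e. $R(G,p)\in \mathrm{Hom}_{\Gamma}(P_V\otimes I_d,P'_E)$, where $P_V\otimes I_d$ and $P'_E$ are the external and the internal representation of $\Gamma$. In other words, $R(G,p)\,(P_V\otimes I_d)(\gamma)=P'_E(\gamma)\,R(G,p)$ for all $\gamma\in\Gamma$.
   Context: Graphs are finite and simple. A (bar-joint) framework $(G,p)$ in $\mathbb{R}^d$ is a graph $G=(V,E)$ with a map $p:V\to\mathbb{R}^d$, $p_i=p(i)$. The rigidity matrix $R(G,p)$ is the $|E|\times d|V|$ matrix whose row for $e=\{i,j\}\in E$ is zero except possibly in the $d$ columns of $i$, where it is $p_i-p_j$, and in the $d$ columns of $j$, where it is $p_j-p_i$. $H\square K_2^{\square t}$ is the Cartesian product of $H$ with $t$ copies of $K_2$, where $V(K_2)=\{0,1\}$: its vertices are $(v,\mathbf e)$ with $v\in V(H)$, $\mathbf e\in\{0,1\}^t$; its edges are $\{(v,\mathbf e),(w,\mathbf e)\}$ with $\{v,w\}\in E(H)$, and $\{(v,\mathbf e),(v,\mathbf e')\}$ with $\mathbf e,\mathbf e'$ differing in exactly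 one entry. $\Gamma=\mathbb{Z}_2^t$ is the additive group $\{0,1\}^t$ modulo $2$. The extrusion action $\theta:\Gamma\to\mathrm{Aut}(G)$ is $\theta(\gamma)(v,\mathbf e)=(v,\mathbf e+\gamma)$ (addition mod 2); write $\gamma i$ for $\theta(\gamma)(i)$, and $\gamma e$ for the induced action on edges. $(G,p)$ has $t$-fold extrusion symmetry with extrusion directions $\tau_1,\ldots,\tau_t\in\mathbb{R}^d\setminus\{0\}$ if for every vertex $(v,\mathbf e)$ and every $\gamma\in\Gamma$, $p_{\gamma(v,\mathbf e)}=p_{(v,\mathbf e)}+\sum_{i\in X}\tau_i-\sum_{g\in Y}\tau_g$, where $X$ is the set of indices at which $\mathbf e$ has entry $0$ and $\gamma$ has entry $1$, and $Y$ is the set of indices at which both $\mathbf e$ and $\gamma$ have entry $1$. $P_V(\gamma)=[\delta_{i,\gamma j}]_{i,j}$ is the permutation matrix of $\gamma$ on $V$, and $P_E(\gamma)$ is the permutation matrix of $\gamma$ on $E$. The external representation is $P_V\otimes I_d:\Gamma\to GL(\mathbb{R}^{d|V|})$, $\gamma\mapsto P_V(\gamma)\otimes I_d$ (Kronecker product). The internal representation $P'_E:\Gamma\to GL(\mathbb{R}^{|E|})$ is obtained from $P_E$ as follows: for each $\gamma$ and each edge $e=\{(v,\mathbf e),(v,\mathbf e')\}$, where $\mathbf e,\mathbf e'$ differ exactly in the $h$-th entry, with $f=\gamma e$, replace the $1$ in the $(e,f)$ and $(f,e)$ entries of $P_E(\gamma)$ by $-1$ if and only if $\gamma$ has a $1$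 in the $h$-th entry; all other entries are unchanged. For representations $\rho_1:\Gamma\to GL(X)$, $\rho_2:\Gamma\to GL(Y)$, a linear map $T:X\to Y$ is $\Gamma$-linear (an element of $\mathrm{Hom}_\Gamma(\rho_1,\rho_2)$) if $T\circ\rho_1(\gamma)=\rho_2(\gamma)\circ T$ for all $\gamma\in\Gamma$. *)

theory Defs
  imports "HOL-Analysis.Analysis" "HOL-Library.Z2"
begin

instance bit :: finite
proof
  have "(UNIV :: bit set) = {0, 1}"
    by (auto intro: bit.exhaust)
  then show "finite (UNIV :: bit set)"
    by (metis finite.emptyI finite.insertI)
qed

text \<open>
  A finite simple graph has the elements of a finite type as its vertices and is given by its set
  of edges, an edge being a two-element set of vertices.
\<close>

definition simple_graph :: "'v::finite set set \<Rightarrow> bool" where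
  "simple_graph E \<longleftrightarrow> (\<forall>e\<in>E. card e = 2)"

text \<open>
  The vertices of the Cartesian product of \<open>H\<close> with \<open>t\<close> copies of \<open>K\<^sub>2\<close> are the pairs
  \<open>(v, a)\<close> with \<open>a\<close> in \<^typ>\<open>bit^'t\<close>, where \<open>t\<close> is \<open>CARD('t)\<close> (so \<open>t \<ge> 1\<close>).
  The same type, with its addition modulo 2, is the group \<open>\<Gamma>\<close>.
\<close>

definition direction_edges :: "'t::finite \<Rightarrow> ('v::finite \<times> (bit^'t)) set set" where
  "direction_edges h = {{(v, a), (v, b)} | v a b. \<forall>k. a $ k \<noteq> b $ k \<longleftrightarrow> k = h}"

definition K2_product :: "'v::finite set set \<Rightarrow> ('v \<times> (bit^'t::finite)) set set" where
  "K2_product EH =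
     {{(v, a), (w, a)} | v w a. {v, w} \<in> EH} \<union> (\<Union>h. direction_edges h)"

definition extrusion_action ::
    "bit^'t::finite \<Rightarrow> 'v::finite \<times> (bit^'t) \<Rightarrow> 'v \<times> (bit^'t)" where
  "extrusion_action \<gamma> = (\<lambda>(v, a). (v, a + \<gamma>))"

definition extrusion_symmetry ::
    "('v::finite \<times> (bit^'t::finite) \<Rightarrow> real^'d::finite) \<Rightarrow> ('t \<Rightarrow> real^'d) \<Rightarrow> bool" where
  "extrusion_symmetry p \<tau> \<longleftrightarrow>
     (\<forall>i. \<tau> i \<noteq> 0) \<and>
     (\<forall>v a \<gamma>. p (extrusion_action \<gamma> (v, a)) =
        p (v, a) + (\<Sum>i | a $ i = 0 \<and> \<gamma> $ i = 1. \<tau> i)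
                 - (\<Sum>g | a $ g = 1 \<and> \<gamma> $ g = 1. \<tau> g))"

text \<open>
  Matrices with rows or columns indexed by the edges use a finite index type \<open>'e\<close> together with a
  bijection \<open>ed\<close> from \<open>'e\<close> to the edge set. The \<open>d\<close> columns of a vertex \<open>i\<close> are indexed by the
  pairs \<open>(i, k)\<close>.
\<close>

definition rigidity_matrix ::
    "('e::finite \<Rightarrow> 'n::finite set) \<Rightarrow> ('n \<Rightarrow> real^'d::finite) \<Rightarrow> real^('n \<times> 'd)^'e" where
  "rigidity_matrix ed p =
     (\<chi> x c. case c of (i, k) \<Rightarrow>
        if i \<in> ed x then (p i - p (THE j. ed x = {i, j})) $ k else 0)"

definition kronecker ::
    "real^'b::finite^'a::finite \<Rightarrow> real^'d::finite^'c::finite \<Rightarrow> real^('b \<times> 'd)^('a \<times> 'c)" where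
  "kronecker A B = (\<chi> r c. A $ fst r $ fst c * B $ snd r $ snd c)"

definition vertex_perm :: "bit^'t::finite \<Rightarrow> real^('v::finite \<times> (bit^'t))^('v \<times> (bit^'t))" where
  "vertex_perm \<gamma> = (\<chi> i j. if i = extrusion_action \<gamma> j then 1 else 0)"

definition edge_perm ::
    "('e::finite \<Rightarrow> ('v::finite \<times> (bit^'t::finite)) set) \<Rightarrow> bit^'t \<Rightarrow> real^'e^'e" where
  "edge_perm ed \<gamma> = (\<chi> x y. if ed x = extrusion_action \<gamma> ` ed y then 1 else 0)"

definition external_rep ::
    "bit^'t::finite \<Rightarrow> real^(('v::finite \<times> (bit^'t)) \<times> 'd::finite)^(('v \<times> (bit^'t)) \<times> 'd)" where
  "external_rep \<gamma> = kronecker (vertex_perm \<gamma>) (mat 1)"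

definition internal_rep ::
    "('e::finite \<Rightarrow> ('v::finite \<times> (bit^'t::finite)) set) \<Rightarrow> bit^'t \<Rightarrow> real^'e^'e" where
  "internal_rep ed \<gamma> =
     (\<chi> x y.
        if \<exists>h. \<gamma> $ h = 1 \<and>
             (ed x \<in> direction_edges h \<and> ed y = extrusion_action \<gamma> ` ed x \<or>
              ed y \<in> direction_edges h \<and> ed x = extrusion_action \<gamma> ` ed y)
        then - 1 else edge_perm ed \<gamma> $ x $ y)"

definition group_representation :: "('g::group_add \<Rightarrow> 'x::real_vector \<Rightarrow> 'x) \<Rightarrow> bool" where
  "group_representation \<rho> \<longleftrightarrow>
     (\<forall>\<gamma>. linear (\<rho> \<gamma>) \<and> bij (\<rho> \<gamma>)) \<and> (\<forall>\<gamma> \<delta>. \<rho> (\<gamma> + \<delta>) = \<rho> \<gamma> \<circ> \<rho> \<delta>)"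

definition Hom_rep ::
    "('g::group_add \<Rightarrow> 'x::real_vector \<Rightarrow> 'x) \<Rightarrow> ('g \<Rightarrow> 'y::real_vector \<Rightarrow> 'y) \<Rightarrow> ('x \<Rightarrow> 'y) set" where
  "Hom_rep \<rho>\<^sub>1 \<rho>\<^sub>2 =
     {T. group_representation \<rho>\<^sub>1 \<and> group_representation \<rho>\<^sub>2 \<and> linear T \<and>
         (\<forall>\<gamma>. T \<circ> \<rho>\<^sub>1 \<gamma> = \<rho>\<^sub>2 \<gamma> \<circ> T)}"

end

theory Submission
  imports Defs
begin

text \<open>
  Extrusion symmetry amounts to \<open>p (v, a) = p (v, 0) + (\<Sum>i | a $ i = 1. \<tau> i)\<close>. Hence the edge vector
  of a copy of an edge of \<open>H\<close> does not depend on \<open>a\<close>, whereas that of an edge in direction \<open>h\<close> is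
  \<open>\<plusminus>\<tau> h\<close> and is reversed by \<open>\<gamma>\<close> exactly if \<open>\<gamma> $ h = 1\<close>. The internal representation permutes the
  edges with precisely these signs.
\<close>

text \<open>For an edge e, this is the only nonzero entry in the row of e in
  \<open>internal_rep ed \<gamma>\<close>. It separates the signs from the permutation.\<close>

definition edge_sign :: "bit^'t::finite \<Rightarrow> ('v::finite \<times> (bit^'t)) set \<Rightarrow> real" where
  "edge_sign \<gamma> e = (if \<exists>h. \<gamma> $ h = 1 \<and> e \<in> direction_edges h then - 1 else 1)"

section \<open>The group action on vertices, direction classes and edges\<close>

lemma bit_vec_add_self [simp]: "(x :: bit^'t::finite) + x = 0"
  by (simp add: vec_eq_iff)

lemma bit_vec_add_cancel_right [simp]: "(y :: bit^'t::finite) + x + x = y"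
  by (simp add: add.assoc)

lemma extrusion_action_pair [simp]: "extrusion_action \<gamma> (v, a) = (v, a + \<gamma>)"
  by (simp add: extrusion_action_def)

lemma extrusion_action_zero [simp]: "extrusion_action 0 = id"
  by (auto simp: extrusion_action_def)

lemma extrusion_action_add:
  "extrusion_action (\<gamma> + \<delta>) i = extrusion_action \<gamma> (extrusion_action \<delta> i)"
  by (cases i) (simp add: ac_simps)

lemma extrusion_action_involutive [simp]:
  "extrusion_action \<gamma> (extrusion_action \<gamma> i) = i"
  by (cases i) simp

lemma extrusion_action_image_involutive [simp]:
  "extrusion_action \<gamma> ` extrusion_action \<gamma> ` e = e"
  by (simp add: image_image)

lemma inj_extrusion_action [simp]: "inj (extrusion_action \<gamma>)"
  by (metis extrusion_action_involutive injI)

text \<open>Every group element is its own inverse. Hence the two disjuncts in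
  \<open>internal_rep\<close> relate the same pairs of edges.\<close>

lemma extrusion_action_image_swap:
  "e = extrusion_action \<gamma> ` f \<longleftrightarrow> f = extrusion_action \<gamma> ` e"
  by (metis extrusion_action_image_involutive)

lemma pair_in_direction_edges_iff:
  "{(v, a), (w, b)} \<in> direction_edges h \<longleftrightarrow> v = w \<and> (\<forall>k. a $ k \<noteq> b $ k \<longleftrightarrow> k = h)"
proof
  assume "{(v, a), (w, b)} \<in> direction_edges h"
  then obtain u c d where "{(v, a), (w, b)} = {(u, c), (u, d)}" "\<forall>k. c $ k \<noteq> d $ k \<longleftrightarrow> k = h"
    unfolding direction_edges_def by blast
  then show "v = w \<and> (\<forall>k. a $ k \<noteq> b $ k \<longleftrightarrow> k = h)"
    by (metis doubleton_eq_iff prod.inject)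
next
  assume "v = w \<and> (\<forall>k. a $ k \<noteq> b $ k \<longleftrightarrow> k = h)"
  then show "{(v, a), (w, b)} \<in> direction_edges h"
    unfolding direction_edges_def by blast
qed

text \<open>Adding \<gamma> to both ends preserves the set of coordinates in which they
  differ.\<close>

lemma extrusion_action_direction_edges:
  assumes "e \<in> direction_edges h"
  shows "extrusion_action \<gamma> ` e \<in> direction_edges h"
proof -
  obtain v a b where e: "e = {(v, a), (v, b)}" "\<forall>k. a $ k \<noteq> b $ k \<longleftrightarrow> k = h"
    using assms unfolding direction_edges_def by blast
  show ?thesis
    using e(2) by (simp only: e(1) image_insert image_empty extrusion_action_pair
        pair_in_direction_edges_iff vector_add_component add_right_cancel simp_thms)
qed

lemma extrusion_action_direction_edges_iff [simp]:
  "extrusion_action \<gamma> ` e \<in> direction_edges h \<longleftrightarrow> e \<in> direction_edges h"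
  by (metis extrusion_action_direction_edges extrusion_action_image_involutive)

text \<open>The two ends differ in exactly one coordinate, which the edge determines. So the
  existential in \<open>edge_sign\<close> tests a single coordinate of \<gamma>.\<close>

lemma direction_edges_unique:
  assumes "e \<in> direction_edges h" "e \<in> direction_edges g"
  shows "h = g"
proof -
  obtain v a b where e: "e = {(v, a), (v, b)}" "\<forall>k. a $ k \<noteq> b $ k \<longleftrightarrow> k = h"
    using assms unfolding direction_edges_def by blast
  show ?thesis
    using assms(2) e unfolding e(1) pair_in_direction_edges_iff by blast
qed

text \<open>Direction classes are invariant, and a copy of an edge of H moves from layer a to layer
  a + \<gamma>.\<close>

lemma extrusion_action_K2_product:
  assumes "e \<in> K2_product EH"
  shows "extrusion_action \<gamma> ` e \<in> K2_product EH"
proof (cases "\<exists>h. e \<in> direction_edges h")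
  case True
  then show ?thesis
    by (auto simp: K2_product_def)
next
  case False
  then obtain v w a where "e = {(v, a), (w, a)}" "{v, w} \<in> EH"
    using assms by (auto simp: K2_product_def)
  then show ?thesis
    by (auto simp: K2_product_def)
qed

lemma K2_product_edgeE:
  assumes "simple_graph EH" "e \<in> K2_product EH"
  obtains i j where "e = {i, j}" "i \<noteq> j"
proof (cases "\<exists>h. e \<in> direction_edges h")
  case True
  then obtain h v a b where "e = {(v, a), (v, b)}" "\<forall>k. a $ k \<noteq> b $ k \<longleftrightarrow> k = h"
    unfolding direction_edges_def by blast
  then show ?thesis
    using that by blast
next
  case False
  then obtain v w a where "e = {(v, a), (w, a)}" "{v, w} \<in> EH"
    using assms by (auto simp: K2_product_def)
  moreover from this have "v \<noteq> w"
    using assms(1) by (auto simp: simple_graph_def)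
  ultimately show ?thesis
    using that by blast
qed

section \<open>Edge signs as characters of the group\<close>

lemma edge_sign_direction:
  assumes "e \<in> direction_edges h"
  shows "edge_sign \<gamma> e = (if \<gamma> $ h = 1 then - 1 else 1)"
  using assms direction_edges_unique by (fastforce simp: edge_sign_def)

lemma edge_sign_zero [simp]: "edge_sign 0 e = 1"
  by (simp add: edge_sign_def)

lemma edge_sign_image [simp]: "edge_sign \<delta> (extrusion_action \<gamma> ` e) = edge_sign \<delta> e"
  by (simp add: edge_sign_def)

text \<open>On an edge in direction h the sign is (-1) to the power \<gamma> $ h, a character of the
  group; on any other set it is the trivial character.\<close>

lemma edge_sign_add: "edge_sign (\<gamma> + \<delta>) e = edge_sign \<gamma> e * edge_sign \<delta> e"
proof (cases "\<exists>h. e \<in> direction_edges h")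
  case True
  then obtain h where "e \<in> direction_edges h" ..
  then show ?thesis
    by (cases "\<gamma> $ h"; cases "\<delta> $ h") (simp_all add: edge_sign_direction)
next
  case False
  then show ?thesis
    by (simp add: edge_sign_def)
qed

section \<open>Positions and edge vectors under extrusion symmetry\<close>

lemma extrusion_symmetry_position:
  assumes "extrusion_symmetry p \<tau>"
  shows "p (v, a) = p (v, 0) + (\<Sum>i\<in>UNIV. if a $ i = 1 then \<tau> i else 0)"
proof -
  \<comment> \<open>The symmetry is applied to the base vertex (v, 0) with a as the group element.
    The subtracted sum is then empty.\<close>
  have "p (extrusion_action a (v, 0)) = p (v, 0) + (\<Sum>i | 0 $ i = (0 :: bit) \<and> a $ i = 1. \<tau> i)
      - (\<Sum>g | 0 $ g = (1 :: bit) \<and> a $ g = 1. \<tau> g)"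
    using assms unfolding extrusion_symmetry_def by blast
  then show ?thesis
    by (simp add: sum.If_cases)
qed

lemma extrusion_symmetry_direction:
  assumes "extrusion_symmetry p \<tau>" "\<forall>k. a $ k \<noteq> b $ k \<longleftrightarrow> k = h"
  shows "p (v, a) - p (v, b) = (if a $ h = 1 then \<tau> h else - \<tau> h)"
proof -
  have "p (v, a) - p (v, b) =
      (\<Sum>i\<in>UNIV. (if a $ i = 1 then \<tau> i else 0) - (if b $ i = 1 then \<tau> i else 0))"
    by (simp add: extrusion_symmetry_position[OF assms(1), of v a]
        extrusion_symmetry_position[OF assms(1), of v b] sum_subtractf)
  \<comment> \<open>Away from h the vectors a and b agree and the summand vanishes. At h exactly one
    of them has entry 1, and which one it is decides the sign.\<close>
  also have "\<dots> = (\<Sum>i\<in>UNIV. if i = h then if a $ h = 1 then \<tau> h else - \<tau> h else 0)"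
  proof (rule sum.cong)
    fix i
    show "(if a $ i = 1 then \<tau> i else 0) - (if b $ i = 1 then \<tau> i else 0) =
        (if i = h then if a $ h = 1 then \<tau> h else - \<tau> h else 0)"
    proof (cases "i = h")
      case True
      moreover have "a $ h \<noteq> b $ h"
        using assms(2) by blast
      ultimately show ?thesis
        by (cases "a $ h"; cases "b $ h") simp_all
    next
      case False
      moreover from False have "a $ i = b $ i"
        using assms(2) by blast
      ultimately show ?thesis
        by simp
    qed
  qed simp
  finally show ?thesis
    by simp
qed

lemma edge_vector_extrusion_action:
  assumes "extrusion_symmetry p \<tau>" "{i, j} \<in> K2_product EH"
  shows "p (extrusion_action \<gamma> i) - p (extrusion_action \<gamma> j) = edge_sign \<gamma> {i, j} *\<^sub>R (p i - p j)"
proof -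
  obtain v a w b where ij: "i = (v, a)" "j = (w, b)"
    by (metis prod.exhaust)
  show ?thesis
  proof (cases "\<exists>h. {i, j} \<in> direction_edges h")
    case True
    then obtain h where h: "{i, j} \<in> direction_edges h" ..
    then have ab: "w = v" "\<forall>k. a $ k \<noteq> b $ k \<longleftrightarrow> k = h"
      by (auto simp: ij pair_in_direction_edges_iff)
    then have "\<forall>k. (a + \<gamma>) $ k \<noteq> (b + \<gamma>) $ k \<longleftrightarrow> k = h"
      by (simp only: vector_add_component add_right_cancel simp_thms)
    \<comment> \<open>The difference formula is used for the shifted pair and for the original one.
      The two values differ in sign exactly if \<gamma> flips the entry of a at h.\<close>
    note this[THEN extrusion_symmetry_direction[OF assms(1)], of v]
      and ab(2)[THEN extrusion_symmetry_direction[OF assms(1)], of v]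
    then show ?thesis
      by (cases "\<gamma> $ h"; cases "a $ h")
        (simp_all add: edge_sign_direction[OF h[unfolded ij ab(1)]] ij ab(1) del: minus_diff_eq)
  next
    case False
    then have "b = a"
      using assms(2) by (auto simp: ij K2_product_def doubleton_eq_iff)
    moreover have "edge_sign \<gamma> {i, j} = 1"
      using False by (simp add: edge_sign_def)
    \<comment> \<open>Both ends lie in one layer, so their sums of extrusion directions cancel
      before and after the shift.\<close>
    ultimately show ?thesis
      by (simp add: ij extrusion_symmetry_position[OF assms(1), of _ a]
          extrusion_symmetry_position[OF assms(1), of _ "a + \<gamma>"])
  qed
qed

section \<open>The external representation\<close>

lemma external_rep_mult_vec:
  "(external_rep \<gamma> *v u) $ (i, k) = u $ (extrusion_action \<gamma> i, k)"
proof -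
  \<comment> \<open>Row i of the permutation matrix has its 1 in the column of the preimage of i,
    which is also the image of i because \<gamma> is an involution.\<close>
  have "i = extrusion_action \<gamma> j \<longleftrightarrow> j = extrusion_action \<gamma> i" for j
    by auto
  then have "external_rep \<gamma> $ (i, k) $ c = (if c = (extrusion_action \<gamma> i, k) then 1 else 0)" for c
    by (cases c) (auto simp: external_rep_def kronecker_def vertex_perm_def mat_def)
  then show ?thesis
    by (simp add: matrix_vector_mult_def if_distrib[of "\<lambda>r. r * _"] cong: if_cong)
qed

lemma external_rep_representation:
  "group_representation (\<lambda>\<gamma> :: bit^'t::finite. (*v)
    (external_rep \<gamma> :: real^(('v::finite \<times> (bit^'t)) \<times> 'd::finite)^(('v \<times> (bit^'t)) \<times> 'd)))"
  (is "group_representation ?E")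
proof -
  \<comment> \<open>On coordinates the actions compose in the reverse order, which is harmless
    because the group is commutative.\<close>
  have add: "?E (\<gamma> + \<delta>) = ?E \<gamma> \<circ> ?E \<delta>" for \<gamma> \<delta>
    by (auto simp: fun_eq_iff vec_eq_iff external_rep_mult_vec add.commute[of \<gamma>] extrusion_action_add)
  have "?E 0 = id"
    by (auto simp: fun_eq_iff vec_eq_iff external_rep_mult_vec)
  \<comment> \<open>Since \<gamma> + \<gamma> = 0, each map is its own inverse.\<close>
  then have "bij (?E \<gamma>)" for \<gamma>
    by (metis add bit_vec_add_self o_bij)
  then show ?thesis
    using add by (simp add: group_representation_def)
qed

section \<open>The internal representation\<close>

lemma internal_rep_mult_vec:
  assumes "inj ed" "ed y = extrusion_action \<gamma> ` ed x"
  shows "(internal_rep ed \<gamma> *v u) $ x = edge_sign \<gamma> (ed x) * u $ y"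
proof -
  have eq: "ed z = extrusion_action \<gamma> ` ed x \<longleftrightarrow> z = y"
    "ed x = extrusion_action \<gamma> ` ed z \<longleftrightarrow> z = y" for z
    using assms extrusion_action_image_swap by (metis injD)+
  have "ed y \<in> direction_edges h \<longleftrightarrow> ed x \<in> direction_edges h" for h
    by (simp add: assms(2))
  \<comment> \<open>By injectivity of \<open>ed\<close> and invariance of direction classes, both
    disjuncts say that z is the index of the image edge and carry the same sign condition.\<close>
  then have sign: "(\<exists>h. \<gamma> $ h = 1 \<and>
      (ed x \<in> direction_edges h \<and> ed z = extrusion_action \<gamma> ` ed x \<or>
       ed z \<in> direction_edges h \<and> ed x = extrusion_action \<gamma> ` ed z)) \<longleftrightarrow>
      z = y \<and> (\<exists>h. \<gamma> $ h = 1 \<and> ed x \<in> direction_edges h)" for z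
    unfolding eq by blast
  have "internal_rep ed \<gamma> $ x $ z = (if z = y then edge_sign \<gamma> (ed x) else 0)" for z
    unfolding internal_rep_def edge_perm_def edge_sign_def
    unfolding vec_lambda_beta sign unfolding eq by argo
  then show ?thesis
    by (simp add: matrix_vector_mult_def if_distrib[of "\<lambda>r. r * _"] cong: if_cong)
qed

lemma edge_indexE:
  assumes "bij_betw ed UNIV (K2_product EH)"
  obtains y where "ed y = extrusion_action \<gamma> ` ed x"
  by (metis assms bij_betw_iff_bijections extrusion_action_K2_product UNIV_I)

lemma internal_rep_representation:
  fixes ed :: "'e::finite \<Rightarrow> ('v::finite \<times> (bit^'t::finite)) set"
  assumes "bij_betw ed UNIV (K2_product EH)"
  shows "group_representation (\<lambda>\<gamma>. (*v) (internal_rep ed \<gamma>))"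
proof -
  have inj: "inj ed"
    using assms by (simp add: bij_betw_def)
  note mv = internal_rep_mult_vec[OF inj]
  have add: "(*v) (internal_rep ed (\<gamma> + \<delta>)) = (*v) (internal_rep ed \<gamma>) \<circ> (*v) (internal_rep ed \<delta>)"
    for \<gamma> \<delta> :: "bit^'t"
  proof
    fix u
    show "internal_rep ed (\<gamma> + \<delta>) *v u = ((*v) (internal_rep ed \<gamma>) \<circ> (*v) (internal_rep ed \<delta>)) u"
    proof (subst vec_eq_iff, rule)
      fix x
      obtain y where y: "ed y = extrusion_action \<gamma> ` ed x"
        using edge_indexE[OF assms] .
      obtain z where z: "ed z = extrusion_action \<delta> ` ed y"
        using edge_indexE[OF assms] .
      have "ed z = extrusion_action (\<gamma> + \<delta>) ` ed x"
        by (simp add: y z image_image add.commute[of \<gamma>] extrusion_action_add)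
      then show "(internal_rep ed (\<gamma> + \<delta>) *v u) $ x =
          ((*v) (internal_rep ed \<gamma>) \<circ> (*v) (internal_rep ed \<delta>)) u $ x"
        \<comment> \<open>The sign of \<delta> first appears at the image edge \<open>ed y\<close>;
          being constant on orbits, it equals the sign at \<open>ed x\<close>.\<close>
        by (simp add: mv[OF y] mv[OF z] mv[of z "\<gamma> + \<delta>" x] edge_sign_add)
          (simp add: y)
    qed
  qed
  have "(*v) (internal_rep ed 0) = id"
    by (auto simp: fun_eq_iff vec_eq_iff mv[where \<gamma> = 0])
  then have "bij ((*v) (internal_rep ed \<gamma>))" for \<gamma>
    by (metis add bit_vec_add_self o_bij)
  then show ?thesis
    using add by (simp add: group_representation_def)
qed

section \<open>Rows of the rigidity matrix and the intertwining relation\<close>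

lemma rigidity_matrix_mult_vec:
  assumes "ed x = {i, j}" "i \<noteq> j"
  shows "(rigidity_matrix ed p *v u) $ x =
    (\<Sum>k\<in>UNIV. (p i - p j) $ k * (u $ (i, k) - u $ (j, k)))"
proof -
  \<comment> \<open>An edge and one of its ends determine the other end, which is what
    \<open>THE\<close> selects in \<open>rigidity_matrix\<close>.\<close>
  have the: "(THE j'. {i, j} = {i, j'}) = j" "(THE i'. {i, j} = {j, i'}) = i"
    using assms(2) by (auto intro!: the_equality simp: doubleton_eq_iff)
  have "(rigidity_matrix ed p *v u) $ x =
      (\<Sum>l\<in>UNIV. \<Sum>k\<in>UNIV. rigidity_matrix ed p $ x $ (l, k) * u $ (l, k))"
    by (simp add: matrix_vector_mult_def sum.cartesian_product)
  also have "\<dots> = (\<Sum>l\<in>{i, j}. \<Sum>k\<in>UNIV. rigidity_matrix ed p $ x $ (l, k) * u $ (l, k))"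
    by (rule sum.mono_neutral_right) (auto simp: rigidity_matrix_def assms(1))
  also have "\<dots> = (\<Sum>k\<in>UNIV. (p i - p j) $ k * u $ (i, k) + (p j - p i) $ k * u $ (j, k))"
    using assms(2) by (simp add: rigidity_matrix_def assms(1) the sum.distrib)
  finally show ?thesis
    by (simp add: algebra_simps)
qed

text \<open>In each row the sign from the internal representation meets the same sign from the edge
  vector of the image edge, and their product is 1.\<close>

lemma rigidity_matrix_intertwines:
  assumes "simple_graph EH" "bij_betw ed UNIV (K2_product EH)" "extrusion_symmetry p \<tau>"
  shows "rigidity_matrix ed p *v (external_rep \<gamma> *v u) =
    internal_rep ed \<gamma> *v (rigidity_matrix ed p *v u)"
proof (subst vec_eq_iff, rule)
  fix x
  have inj: "inj ed" and x: "ed x \<in> K2_product EH"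
    using assms(2) by (auto simp: bij_betw_def)
  obtain i j where ij: "ed x = {i, j}" "i \<noteq> j"
    using K2_product_edgeE[OF assms(1) x] .
  obtain y where y: "ed y = extrusion_action \<gamma> ` ed x"
    using edge_indexE[OF assms(2)] .
  let ?i = "extrusion_action \<gamma> i" and ?j = "extrusion_action \<gamma> j"
  \<comment> \<open>The row formula is unchanged when the two ends are swapped, so the ends of the
    image edge may be listed as the images of i and j.\<close>
  have y': "ed y = {?i, ?j}" "?i \<noteq> ?j"
    using y ij by (auto simp: inj_eq)
  have sq: "edge_sign \<gamma> {i, j} * edge_sign \<gamma> {i, j} = 1"
    by (simp add: edge_sign_def)
  have diff: "p ?i - p ?j = edge_sign \<gamma> {i, j} *\<^sub>R (p i - p j)"
    using edge_vector_extrusion_action assms(3) x by (metis ij(1))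
  have "(internal_rep ed \<gamma> *v (rigidity_matrix ed p *v u)) $ x =
      edge_sign \<gamma> {i, j} *
        (\<Sum>k\<in>UNIV. (edge_sign \<gamma> {i, j} *\<^sub>R (p i - p j)) $ k * (u $ (?i, k) - u $ (?j, k)))"
    by (simp only: internal_rep_mult_vec[OF inj y] rigidity_matrix_mult_vec[of ed y ?i ?j, OF y'] diff ij(1))
  also have "\<dots> = edge_sign \<gamma> {i, j} * edge_sign \<gamma> {i, j} *
        (\<Sum>k\<in>UNIV. (p i - p j) $ k * (u $ (?i, k) - u $ (?j, k)))"
    by (simp add: sum_distrib_left mult.assoc)
  also have "\<dots> = (rigidity_matrix ed p *v (external_rep \<gamma> *v u)) $ x"
    by (simp only: sq rigidity_matrix_mult_vec[of ed x i j, OF ij] external_rep_mult_vec mult_1_left)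
  finally show "(rigidity_matrix ed p *v (external_rep \<gamma> *v u)) $ x =
      (internal_rep ed \<gamma> *v (rigidity_matrix ed p *v u)) $ x" ..
qed

theorem theorem2p2:
  fixes EH :: "'v::finite set set"
    and ed :: "'e::finite \<Rightarrow> ('v \<times> (bit^'t::finite)) set"
    and p :: "'v \<times> (bit^'t) \<Rightarrow> real^'d::finite"
    and \<tau> :: "'t \<Rightarrow> real^'d"
  assumes "simple_graph EH"
    and "bij_betw ed UNIV (K2_product EH)"
    and "extrusion_symmetry p \<tau>"
  shows "(*v) (rigidity_matrix ed p)
           \<in> Hom_rep (\<lambda>\<gamma>. (*v) (external_rep \<gamma>)) (\<lambda>\<gamma>. (*v) (internal_rep ed \<gamma>))
    \<and> (\<forall>\<gamma>. rigidity_matrix ed p ** external_rep \<gamma> = internal_rep ed \<gamma> ** rigidity_matrix ed p)"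
  using rigidity_matrix_intertwines[OF assms] external_rep_representation
    internal_rep_representation[OF assms(2)]
  by (auto simp: Hom_rep_def fun_eq_iff matrix_eq simp flip: matrix_vector_mul_assoc)

end
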